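(* Let $G\colon\Delta^{27}\to\mathbb{R}$ be defined by $G(\mathbf{x})=\max\{f(\mathbf{x}) : f\in\mathcal{G}\}$, where $\mathcal{G}$ is the set of the $60$ functions $f_l,g_l,h_l,u_l$ on $\Delta^{27}$ listed in the context. Then $\inf_{\mathbf{x}\in\Delta^{27}}G(\mathbf{x})=\alpha=24.8692\ldots$, where $\alpha$ is the unique real root greater than $9$ of the polynomial $21x^4-496x^3-654x^2+24x+81$.
   Context: $\Delta^{27}=\{\mathbf{x}=(x_1,\dots,x_{28})\in\mathbb{R}^{28} : x_l>0 \text{ for all } l,\ \sum_{l=1}^{28}x_l=1\}$, and $\sigma(x)=1/x-1$ for $x\in(0,1)$. Let $I=\{1,\dots,28\}$ and $I_1=\{1,2,3\}$, $I_2=\{4,5,6\}$, $I_3=\{8,9,10\}$, $I_4=\{11,12,13\}$, $I_5=\{15,16,17\}$, $I_6=\{18,19,20\}$, $I_7=\{22,23,24\}$, $I_8=\{25,26,27\}$; $J_1=\{1,\dots,7\}$, $J_2=\{8,\dots,14\}$, $J_3=\{15,\dots,21\}$, $J_4=\{22,\dots,28\}$. Put $\Sigma_J^i(\mathbf{x})=\sum_{l\in J_i}x_l$, $\Sigma_i^J(\mathbf{x})=\sum_{l\in I\setminus J_i}x_l$, $\Sigma_I^j(\mathbf{x})=\sum_{l\in I\setminus I_j}x_l$, $\Sigma^n(\mathbf{x})=\sum_{l\in I\setminus\{n\}}x_l$. The functions in $\mathcal{G}$ are the following. (f) $f_l(\mathbf{x})=\sigma(\Sigma_J^i(\mathbf{x}))\sigma(x_l)$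 for $l\in\{1,5\}$ with $i=1$; $l\in\{9,13\}$ with $i=2$; $l\in\{15,19\}$ with $i=3$; $l\in\{23,27\}$ with $i=4$. $f_l(\mathbf{x})=\sigma(\Sigma_I^j(\mathbf{x}))\sigma(x_l)$ for $l\in\{3,12\}$ with $j=1$; $l\in\{4,20\}$ with $j=2$; $l\in\{10,22\}$ with $j=3$; $l\in\{2,11\}$ with $j=4$; $l\in\{17,26\}$ with $j=5$; $l\in\{6,18\}$ with $j=6$; $l\in\{8,24\}$ with $j=7$; $l\in\{16,25\}$ with $j=8$. $f_7=\sigma(\Sigma_1^J)\sigma(x_7)$, $f_{14}=\sigma(\Sigma_2^J)\sigma(x_{14})$, $f_{21}=\sigma(\Sigma_3^J)\sigma(x_{21})$, $f_{28}=\sigma(\Sigma_4^J)\sigma(x_{28})$. (g) $g_1=\sigma(\Sigma_I^3)\sigma(x_1)$, $g_5=\sigma(\Sigma_I^5)\sigma(x_5)$, $g_9=\sigma(\Sigma_I^8)\sigma(x_9)$, $g_{13}=\sigma(\Sigma_I^2)\sigma(x_{13})$, $g_{15}=\sigma(\Sigma_I^7)\sigma(x_{15})$, $g_{19}=\sigma(\Sigma_I^1)\sigma(x_{19})$, $g_{23}=\sigma(\Sigma_I^4)\sigma(x_{23})$, $g_{27}=\sigma(\Sigma_I^6)\sigma(x_{27})$; $g_3=\sigma(\Sigma^{14})\sigma(x_3)$, $g_4=\sigma(\Sigma^{21})\sigma(x_4)$, $g_{10}=\sigma(\Sigma^{28})\sigma(x_{10})$, $g_{11}=\sigma(\Sigma^{7})\sigma(x_{11})$,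 $g_{17}=\sigma(\Sigma^{28})\sigma(x_{17})$, $g_{18}=\sigma(\Sigma^{7})\sigma(x_{18})$, $g_{24}=\sigma(\Sigma^{14})\sigma(x_{24})$, $g_{25}=\sigma(\Sigma^{21})\sigma(x_{25})$. (h) $h_1=\sigma(\Sigma^{28})\sigma(x_1)$, $h_5=\sigma(\Sigma^{28})\sigma(x_5)$, $h_9=\sigma(\Sigma^{21})\sigma(x_9)$, $h_{13}=\sigma(\Sigma^{21})\sigma(x_{13})$, $h_{15}=\sigma(\Sigma^{14})\sigma(x_{15})$, $h_{19}=\sigma(\Sigma^{14})\sigma(x_{19})$, $h_{23}=\sigma(\Sigma^{7})\sigma(x_{23})$, $h_{27}=\sigma(\Sigma^{7})\sigma(x_{27})$; $h_7=\sigma(\Sigma^{2})\sigma(x_7)$, $h_{14}=\sigma(\Sigma^{8})\sigma(x_{14})$, $h_{21}=\sigma(\Sigma^{16})\sigma(x_{21})$, $h_{28}=\sigma(\Sigma^{22})\sigma(x_{28})$. (u) $u_7=\sigma(\Sigma^{6})\sigma(x_7)$, $u_{14}=\sigma(\Sigma^{12})\sigma(x_{14})$, $u_{21}=\sigma(\Sigma^{20})\sigma(x_{21})$, $u_{28}=\sigma(\Sigma^{26})\sigma(x_{28})$. (All sums are evaluated at $\mathbf{x}$.) *)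

theory Defs
  imports "HOL-Analysis.Analysis" "HOL-Computational_Algebra.Polynomial"
begin

text \<open>
  Points of 28-dimensional real space are functions from the naturals to the reals that are
  extensional on the index set \<open>{1..28}\<close>, so that coordinates carry the labels 1, ..., 28.
\<close>

definition Delta27 :: "(nat \<Rightarrow> real) set" where
  "Delta27 = {x \<in> extensional {1..28}. (\<forall>l\<in>{1..28}. 0 < x l) \<and> (\<Sum>l\<in>{1..28}. x l) = 1}"

definition \<sigma> :: "real \<Rightarrow> real" where
  "\<sigma> x = 1 / x - 1"

definition idx :: "nat set" where
  "idx = {1..28}"

text \<open>The blocks are numbered from 1, list positions from 0.\<close>

definition I_block :: "nat \<Rightarrow> nat set" where
  "I_block j = [{1,2,3}, {4,5,6}, {8,9,10}, {11,12,13},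
                {15,16,17}, {18,19,20}, {22,23,24}, {25,26,27}] ! (j - 1)"

definition J_block :: "nat \<Rightarrow> nat set" where
  "J_block i = [{1..7}, {8..14}, {15..21}, {22..28}] ! (i - 1)"

text \<open>
  In mathematical notation, \<open>S_J i\<close>, \<open>S_Jc i\<close>, \<open>S_Ic j\<close> and \<open>S_pt n\<close> are
  \<open>\<Sigma>\<^sub>J\<^sup>i\<close>, \<open>\<Sigma>\<^sub>i\<^sup>J\<close>, \<open>\<Sigma>\<^sub>I\<^sup>j\<close> and \<open>\<Sigma>\<^sup>n\<close>; only the first is a sum over the block
  itself, the others are sums over complements.
\<close>

definition S_J :: "nat \<Rightarrow> (nat \<Rightarrow> real) \<Rightarrow> real" where
  "S_J i x = (\<Sum>l\<in>J_block i. x l)"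

definition S_Jc :: "nat \<Rightarrow> (nat \<Rightarrow> real) \<Rightarrow> real" where
  "S_Jc i x = (\<Sum>l\<in>idx - J_block i. x l)"

definition S_Ic :: "nat \<Rightarrow> (nat \<Rightarrow> real) \<Rightarrow> real" where
  "S_Ic j x = (\<Sum>l\<in>idx - I_block j. x l)"

definition S_pt :: "nat \<Rightarrow> (nat \<Rightarrow> real) \<Rightarrow> real" where
  "S_pt n x = (\<Sum>l\<in>idx - {n}. x l)"

text \<open>
  Each function below has the form \<open>\<sigma> (S k x) * \<sigma> (x l)\<close>; a pair \<open>(l, k)\<close> lists the index
  \<open>l\<close> of the function together with the index \<open>k\<close> of the partial sum in its first factor.
\<close>

definition f_funs :: "((nat \<Rightarrow> real) \<Rightarrow> real) set" where
  "f_funs =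
     (\<lambda>(l, i) x. \<sigma> (S_J i x) * \<sigma> (x l)) `
       {(1,1), (5,1), (9,2), (13,2), (15,3), (19,3), (23,4), (27,4)} \<union>
     (\<lambda>(l, j) x. \<sigma> (S_Ic j x) * \<sigma> (x l)) `
       {(3,1), (12,1), (4,2), (20,2), (10,3), (22,3), (2,4), (11,4),
        (17,5), (26,5), (6,6), (18,6), (8,7), (24,7), (16,8), (25,8)} \<union>
     (\<lambda>(l, i) x. \<sigma> (S_Jc i x) * \<sigma> (x l)) `
       {(7,1), (14,2), (21,3), (28,4)}"

definition g_funs :: "((nat \<Rightarrow> real) \<Rightarrow> real) set" where
  "g_funs =
     (\<lambda>(l, j) x. \<sigma> (S_Ic j x) * \<sigma> (x l)) `
       {(1,3), (5,5), (9,8), (13,2), (15,7), (19,1), (23,4), (27,6)} \<union>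
     (\<lambda>(l, n) x. \<sigma> (S_pt n x) * \<sigma> (x l)) `
       {(3,14), (4,21), (10,28), (11,7), (17,28), (18,7), (24,14), (25,21)}"

definition h_funs :: "((nat \<Rightarrow> real) \<Rightarrow> real) set" where
  "h_funs =
     (\<lambda>(l, n) x. \<sigma> (S_pt n x) * \<sigma> (x l)) `
       {(1,28), (5,28), (9,21), (13,21), (15,14), (19,14), (23,7), (27,7),
        (7,2), (14,8), (21,16), (28,22)}"

definition u_funs :: "((nat \<Rightarrow> real) \<Rightarrow> real) set" where
  "u_funs =
     (\<lambda>(l, n) x. \<sigma> (S_pt n x) * \<sigma> (x l)) ` {(7,6), (14,12), (21,20), (28,26)}"

definition \<G> :: "((nat \<Rightarrow> real) \<Rightarrow> real) set" where
  "\<G> = f_funs \<union> g_funs \<union> h_funs \<union> u_funs"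

definition G :: "(nat \<Rightarrow> real) \<Rightarrow> real" where
  "G x = Max {f x | f. f \<in> \<G>}"

definition alpha_poly :: "real poly" where
  "alpha_poly = [:81, 24, - 654, - 496, 21:]"

end

theory Submission
  imports Defs
begin

text \<open>
  Put \<open>\<psi> t = odds_div \<alpha> t = t / (\<alpha> - (\<alpha> - 1) * t)\<close>;
  it divides the odds \<open>t / (1 - t)\<close> by \<open>\<alpha>\<close>. For \<open>s, t\<close> in the
  unit interval,
  \<open>\<sigma> s * \<sigma> t < \<alpha>\<close> means \<open>\<psi> (1 - s) < t\<close>, and \<open>\<psi>\<close> is increasing and convex.
  If \<open>G x < \<alpha>\<close>, the 28 functions \<open>f\<^sub>l\<close> bound every coordinate from below by \<open>\<psi>\<close> of a block
  sum; adding these bounds and using the tangents of \<open>\<psi>\<close> at the values taken at the symmetric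
  point contradicts the fact that the coordinates sum to 1. At the symmetric point, whose existence is
  the polynomial equation for \<open>\<alpha>\<close>, all \<open>f\<^sub>l\<close> equal \<open>\<alpha>\<close>, and the remaining functions do not
  exceed \<open>\<alpha>\<close> because \<open>\<psi>\<close> is increasing.
\<close>

section \<open>Inequalities for the odds-dividing function\<close>

definition odds_div :: "real \<Rightarrow> real \<Rightarrow> real" where
  "odds_div a t = t / (a - (a - 1) * t)"

lemma odds_div_denom_pos:
  fixes a t :: real
  assumes "1 < a" "t \<le> 1"
  shows "0 < a - (a - 1) * t"
proof -
  have "0 \<le> (a - 1) * (1 - t)"
    using assms by simp
  then show ?thesis
    by (simp add: algebra_simps)
qed

text \<open>Once the positive denominators are cleared, the inequality is linear in \<open>t\<close>
  and can be solved for it. The strict form serves the lower bound, the form with \<le> the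
  symmetric point.\<close>

lemma sigma_mult_less_iff:
  assumes "1 < a" "0 < s" "s < 1" "0 < t" "t < 1"
  shows "\<sigma> s * \<sigma> t < a \<longleftrightarrow> odds_div a (1 - s) < t"
proof -
  have d: "0 < a - (a - 1) * (1 - s)"
    using assms by (intro odds_div_denom_pos) auto
  have "\<sigma> s * \<sigma> t = (1 - s) * (1 - t) / (s * t)"
    using assms by (simp add: \<sigma>_def field_simps)
  then have "\<sigma> s * \<sigma> t < a \<longleftrightarrow> (1 - s) * (1 - t) < a * (s * t)"
    using assms by (simp add: pos_divide_less_eq)
  also have "\<dots> \<longleftrightarrow> 1 - s < t * (a - (a - 1) * (1 - s))"
    by (simp add: algebra_simps)
  also have "\<dots> \<longleftrightarrow> odds_div a (1 - s) < t"
    using d by (simp add: odds_div_def pos_divide_less_eq)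
  finally show ?thesis .
qed

lemma sigma_mult_le_iff:
  assumes "1 < a" "0 < s" "s < 1" "0 < t" "t < 1"
  shows "\<sigma> s * \<sigma> t \<le> a \<longleftrightarrow> odds_div a (1 - s) \<le> t"
proof -
  have d: "0 < a - (a - 1) * (1 - s)"
    using assms by (intro odds_div_denom_pos) auto
  have "\<sigma> s * \<sigma> t = (1 - s) * (1 - t) / (s * t)"
    using assms by (simp add: \<sigma>_def field_simps)
  then have "\<sigma> s * \<sigma> t \<le> a \<longleftrightarrow> (1 - s) * (1 - t) \<le> a * (s * t)"
    using assms by (simp add: pos_divide_le_eq)
  also have "\<dots> \<longleftrightarrow> 1 - s \<le> t * (a - (a - 1) * (1 - s))"
    by (simp add: algebra_simps)
  also have "\<dots> \<longleftrightarrow> odds_div a (1 - s) \<le> t"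
    using d by (simp add: odds_div_def pos_divide_le_eq)
  finally show ?thesis .
qed

lemma odds_div_diff:
  assumes "1 < a" "s \<le> 1" "t \<le> 1"
  shows "odds_div a t - odds_div a s
    = a * (t - s) / ((a - (a - 1) * s) * (a - (a - 1) * t))"
  using odds_div_denom_pos[OF assms(1,2)] odds_div_denom_pos[OF assms(1,3)]
  unfolding odds_div_def by (simp add: field_simps)

lemma odds_div_mono:
  assumes "1 < a" "s \<le> t" "t \<le> 1"
  shows "odds_div a s \<le> odds_div a t"
proof -
  have "0 \<le> odds_div a t - odds_div a s"
    using assms odds_div_denom_pos[of a s] odds_div_denom_pos[of a t]
    by (subst odds_div_diff) auto
  then show ?thesis by simp
qed

text \<open>The derivative of \<open>odds_div a\<close> at \<open>s\<close>.\<close>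

definition odds_div_slope :: "real \<Rightarrow> real \<Rightarrow> real" where
  "odds_div_slope a s = a / (a - (a - 1) * s)\<^sup>2"

text \<open>With \<open>p\<close> and \<open>q\<close> the two denominators, the gap between
  function and tangent is \<open>a * (a - 1) * (t - s)\<^sup>2 / (p\<^sup>2 * q)\<close>.\<close>

lemma odds_div_tangent:
  assumes "1 < a" "s \<le> 1" "t \<le> 1"
  shows "odds_div a s + odds_div_slope a s * (t - s) \<le> odds_div a t"
proof -
  define p q where "p = a - (a - 1) * s" and "q = a - (a - 1) * t"
  have pq: "0 < p" "0 < q"
    using odds_div_denom_pos[OF assms(1,2)] odds_div_denom_pos[OF assms(1,3)]
    by (simp_all add: p_def q_def)
  have "odds_div a t - odds_div a s - odds_div_slope a s * (t - s)
      = a * (t - s) * (p - q) / (p\<^sup>2 * q)"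
    using pq unfolding odds_div_diff[OF assms] odds_div_slope_def p_def[symmetric] q_def[symmetric]
    by (simp add: field_simps power2_eq_square)
  also have "p - q = (a - 1) * (t - s)"
    by (simp add: p_def q_def algebra_simps)
  also have "a * (t - s) * ((a - 1) * (t - s)) / (p\<^sup>2 * q)
      = a * (a - 1) * (t - s)\<^sup>2 / (p\<^sup>2 * q)"
    by (simp add: power2_eq_square)
  also have "\<dots> \<ge> 0"
    using pq assms by simp
  finally show ?thesis by simp
qed

text \<open>Jensen's inequality with a free base point: the slope term vanishes when
  \<open>s\<close> is the mean of the values, and remains for the \<open>I_block\<close> sums, whose
  mean is not fixed.\<close>

lemma sum_odds_div_tangent:
  assumes "1 < a" "s \<le> 1" "\<And>i. i \<in> S \<Longrightarrow> y i \<le> 1"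
  shows "real (card S) * odds_div a s + odds_div_slope a s * (sum y S - real (card S) * s)
    \<le> (\<Sum>i\<in>S. odds_div a (y i))"
proof -
  have "(\<Sum>i\<in>S. odds_div a s + odds_div_slope a s * (y i - s)) \<le> (\<Sum>i\<in>S. odds_div a (y i))"
    using assms by (intro sum_mono odds_div_tangent) auto
  then show ?thesis
    by (simp add: sum.distrib sum_subtractf flip: sum_distrib_left)
qed

section \<open>Block sums on the simplex\<close>

definition S_I :: "nat \<Rightarrow> (nat \<Rightarrow> real) \<Rightarrow> real" where
  "S_I j x = sum x (I_block j)"

lemma idx_explicit:
  "idx = {1,2,3,4,5,6,7,8,9,10,11,12,13,14,15,16,17,18,19,20,21,22,23,24,25,26,27,28}"
  by (simp add: idx_def atLeastAtMost_upt upt_rec[of "Suc 0"] del: set_upt flip: numeral_2_eq_2)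

lemma J_block_explicit:
  "J_block (Suc 0) = {1,2,3,4,5,6,7}" "J_block 2 = {8,9,10,11,12,13,14}"
  "J_block 3 = {15,16,17,18,19,20,21}" "J_block 4 = {22,23,24,25,26,27,28}"
  by (simp_all add: J_block_def atLeastAtMost_upt upt_rec[of "Suc 0"] del: set_upt
      flip: numeral_2_eq_2)

lemma I_block_explicit:
  "I_block (Suc 0) = {1,2,3}" "I_block 2 = {4,5,6}" "I_block 3 = {8,9,10}" "I_block 4 = {11,12,13}"
  "I_block 5 = {15,16,17}" "I_block 6 = {18,19,20}" "I_block 7 = {22,23,24}" "I_block 8 = {25,26,27}"
  by (simp_all add: I_block_def)

lemma J_block_psubset:
  assumes "i \<in> {1,2,3,4}"
  shows "J_block i \<subset> idx" "J_block i \<noteq> {}"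
proof -
  have "J_block i \<subseteq> idx" "\<not> (1 \<in> J_block i \<and> 28 \<in> J_block i)" "1 \<in> idx" "28 \<in> idx"
    using assms by (auto simp: J_block_explicit idx_def)
  then show "J_block i \<subset> idx" by blast
  show "J_block i \<noteq> {}"
    using assms by (auto simp: J_block_explicit)
qed

lemma I_block_psubset:
  assumes "j \<in> {1,2,3,4,5,6,7,8}"
  shows "I_block j \<subset> idx" "I_block j \<noteq> {}"
proof -
  have "I_block j \<subseteq> idx" "7 \<notin> I_block j" "7 \<in> idx"
    using assms by (auto simp: I_block_explicit idx_def)
  then show "I_block j \<subset> idx" by blast
  show "I_block j \<noteq> {}"
    using assms by (auto simp: I_block_explicit)
qed

lemma Delta27_sum_compl:
  assumes "x \<in> Delta27" "K \<subseteq> idx"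
  shows "sum x (idx - K) = 1 - sum x K"
  using assms sum_diff[of idx K x] by (simp add: Delta27_def idx_def)

lemma Delta27_sum_pos:
  assumes "x \<in> Delta27" "K \<subseteq> idx" "K \<noteq> {}"
  shows "0 < sum x K"
  using assms finite_subset[of K "{1..28}"]
  by (intro sum_pos) (auto simp: Delta27_def idx_def)

lemma Delta27_sum_less_1:
  assumes "x \<in> Delta27" "K \<subset> idx"
  shows "sum x K < 1"
proof -
  have "0 < sum x (idx - K)"
    using assms by (intro Delta27_sum_pos) blast+
  then show ?thesis
    using Delta27_sum_compl[OF assms(1) psubset_imp_subset[OF assms(2)]] by simp
qed

lemma singleton_psubset_idx:
  assumes "n \<in> idx"
  shows "{n} \<subset> idx"
proof -
  have "(if n = 1 then 2 else 1) \<in> idx - {n}"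
    by (simp add: idx_def)
  then show ?thesis
    using assms by blast
qed

lemma Delta27_coord:
  assumes "x \<in> Delta27" "l \<in> idx"
  shows "0 < x l" "x l < 1"
  using assms Delta27_sum_less_1[OF assms(1) singleton_psubset_idx[OF assms(2)]]
  by (simp_all add: Delta27_def idx_def)

text \<open>A general \<open>K\<close> makes blocks and complements of blocks instances of one
  statement.\<close>

lemma Delta27_sigma_less_iff:
  assumes "x \<in> Delta27" "1 < a" "K \<subset> idx" "K \<noteq> {}" "l \<in> idx"
  shows "\<sigma> (sum x K) * \<sigma> (x l) < a \<longleftrightarrow> odds_div a (1 - sum x K) < x l"
  using Delta27_sum_pos[OF assms(1) psubset_imp_subset[OF assms(3)] assms(4)]
    Delta27_sum_less_1[OF assms(1,3)] Delta27_coord[OF assms(1,5)] assms(2)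
  by (intro sigma_mult_less_iff)

lemma Delta27_sigma_le_iff:
  assumes "x \<in> Delta27" "1 < a" "K \<subset> idx" "K \<noteq> {}" "l \<in> idx"
  shows "\<sigma> (sum x K) * \<sigma> (x l) \<le> a \<longleftrightarrow> odds_div a (1 - sum x K) \<le> x l"
  using Delta27_sum_pos[OF assms(1) psubset_imp_subset[OF assms(3)] assms(4)]
    Delta27_sum_less_1[OF assms(1,3)] Delta27_coord[OF assms(1,5)] assms(2)
  by (intro sigma_mult_le_iff)

lemma S_Ic_eq: "x \<in> Delta27 \<Longrightarrow> j \<in> {1,2,3,4,5,6,7,8} \<Longrightarrow> S_Ic j x = 1 - S_I j x"
  unfolding S_Ic_def S_I_def using I_block_psubset by (intro Delta27_sum_compl) blast+

lemma S_Jc_eq: "x \<in> Delta27 \<Longrightarrow> i \<in> {1,2,3,4} \<Longrightarrow> S_Jc i x = 1 - S_J i x"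
  unfolding S_Jc_def S_J_def using J_block_psubset by (intro Delta27_sum_compl) blast+

lemma S_pt_eq: "x \<in> Delta27 \<Longrightarrow> n \<in> idx \<Longrightarrow> S_pt n x = 1 - x n"
  unfolding S_pt_def by (subst Delta27_sum_compl) auto

section \<open>The maximum over the finite family\<close>

lemma finite_G: "finite \<G>"
  unfolding \<G>_def f_funs_def g_funs_def h_funs_def u_funs_def
  by (intro finite_UnI finite_imageI finite.intros)

lemma G_nonempty: "\<G> \<noteq> {}"
  unfolding \<G>_def f_funs_def by blast

lemma G_eq: "G x = Max ((\<lambda>f. f x) ` \<G>)"
  by (simp add: G_def setcompr_eq_image)

lemma G_less_iff: "G x < a \<longleftrightarrow> (\<forall>f\<in>\<G>. f x < a)"
  unfolding G_eq using finite_G G_nonempty by (subst Max_less_iff) auto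

lemma G_le_iff: "G x \<le> a \<longleftrightarrow> (\<forall>f\<in>\<G>. f x \<le> a)"
  unfolding G_eq using finite_G G_nonempty by (subst Max_le_iff) auto

section \<open>Equations satisfied by the symmetric point\<close>

text \<open>The sum over each \<open>I_block j\<close> at the symmetric point.\<close>

definition block_value :: "real \<Rightarrow> real" where
  "block_value a = 3 * (a - 1) / (8 * (3 * a + 1))"

text \<open>The upper bound keeps the slope at \<open>block_value a\<close> at most 1/2; the lower
  one puts \<open>odds_div a (1 / 4)\<close> below \<open>block_value a\<close>.\<close>

lemma block_value_bounds:
  assumes "9 < a"
  shows "1 / 12 < block_value a" "block_value a < 1 / 8"
  using assms by (simp_all add: block_value_def field_simps)

text \<open>A \<open>J_block\<close> is two of the \<open>I_block\<close> sets and one further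
  index, and its sum at the symmetric point is 1/4; \<open>block_value\<close> solves this
  equation.\<close>

lemma block_value_J:
  assumes "9 < a"
  shows "2 * block_value a + odds_div a (1 / 4) = 1 / 4"
proof -
  have "a - (a - 1) * (1 / 4) \<noteq> 0" "odds_div a (1 / 4) = 1 / (3 * a + 1)"
    using assms by (simp_all add: odds_div_def field_simps)
  then show ?thesis
    using assms by (simp add: block_value_def field_simps)
qed

text \<open>The consistency condition for one \<open>I_block\<close>, made of one large and two
  small coordinates. This is where the quartic arises.\<close>

lemma block_value_I:
  assumes "9 < a" "poly alpha_poly a = 0"
  shows "odds_div a (3 / 4) + 2 * odds_div a (block_value a) = block_value a"
proof -
  define q where "q = 21 * a\<^sup>2 + 14 * a - 3"
  have "0 < q"
    unfolding q_def using assms(1) zero_le_power2[of a] by linarith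
  have 1: "odds_div a (3 / 4) = 3 / (a + 3)"
    using assms by (simp add: odds_div_def field_simps)
  have "a - (a - 1) * block_value a = q / (8 * (3 * a + 1))"
    using assms(1) by (simp add: block_value_def q_def field_simps power2_eq_square)
  then have 2: "odds_div a (block_value a) = 3 * (a - 1) / q"
    using assms(1) by (simp add: odds_div_def block_value_def)
  \<comment> \<open>The claim with denominators cleared; right side minus left side is exactly
    \<open>poly alpha_poly a\<close>.\<close>
  have "8 * (3 * a + 1) * q + 16 * (a - 1) * (a + 3) * (3 * a + 1) = (a - 1) * (a + 3) * q"
    using assms(2) unfolding alpha_poly_def q_def by simp algebra
  then show ?thesis
    using \<open>0 < q\<close> assms(1) unfolding 1 2
    by (simp add: block_value_def divide_simps) algebra
qed

section \<open>Lower bound on the simplex\<close>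

lemma G_ge:
  assumes a: "9 < a" "poly alpha_poly a = 0" and x: "x \<in> Delta27"
  shows "a \<le> G x"
proof (rule ccontr)
  define \<psi> where "\<psi> = odds_div a"
  define b where "b = block_value a"
  assume "\<not> a \<le> G x"
  then have "\<forall>f\<in>f_funs. f x < a"
    using G_less_iff[of x a] by (auto simp: \<G>_def)
  note f = this[unfolded f_funs_def ball_Un ball_simps image_iff]
  have Jl: "\<psi> (1 - S_J i x) < x l"
    if "(l, i) \<in> {(1,1), (5,1), (9,2), (13,2), (15,3), (19,3), (23,4), (27,4)}" for l i
  proof -
    have "\<sigma> (S_J i x) * \<sigma> (x l) < a" "i \<in> {1,2,3,4}" "l \<in> idx"
      using that f by (auto simp: idx_def)
    then show ?thesis
      using Delta27_sigma_less_iff[OF x, of a "J_block i" l] a(1) J_block_psubset[of i]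
      by (simp add: S_J_def \<psi>_def)
  qed
  have Il: "\<psi> (S_I j x) < x l"
    if "(l, j) \<in> {(3,1), (12,1), (4,2), (20,2), (10,3), (22,3), (2,4), (11,4),
        (17,5), (26,5), (6,6), (18,6), (8,7), (24,7), (16,8), (25,8)}" for l j
  proof -
    have *: "\<sigma> (S_Ic j x) * \<sigma> (x l) < a" "j \<in> {1,2,3,4,5,6,7,8}" "l \<in> idx"
      using that f by (auto simp: idx_def)
    then have "idx - I_block j \<subset> idx" "idx - I_block j \<noteq> {}"
      using I_block_psubset[of j] by blast+
    then show ?thesis
      using Delta27_sigma_less_iff[OF x, of a "idx - I_block j" l] a(1) * S_Ic_eq[OF x, of j]
      by (simp add: S_Ic_def \<psi>_def)
  qed
  have Jcl: "\<psi> (S_J i x) < x l" if "(l, i) \<in> {(7,1), (14,2), (21,3), (28,4)}" for l i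
  proof -
    have *: "\<sigma> (S_Jc i x) * \<sigma> (x l) < a" "i \<in> {1,2,3,4}" "l \<in> idx"
      using that f by (auto simp: idx_def)
    then have "idx - J_block i \<subset> idx" "idx - J_block i \<noteq> {}"
      using J_block_psubset[of i] by blast+
    then show ?thesis
      using Delta27_sigma_less_iff[OF x, of a "idx - J_block i" l] a(1) * S_Jc_eq[OF x, of i]
      by (simp add: S_Jc_def \<psi>_def)
  qed
  have S_J_bounds: "S_J i x \<le> 1" "0 \<le> S_J i x" if "i \<in> {1,2,3,4}" for i
    using Delta27_sum_less_1[OF x, of "J_block i"] Delta27_sum_pos[OF x, of "J_block i"]
      J_block_psubset[OF that] by (auto simp: S_J_def)
  have S_I_le: "S_I j x \<le> 1" if "j \<in> {1,2,3,4,5,6,7,8}" for j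
    using Delta27_sum_less_1[OF x, of "I_block j"] I_block_psubset[OF that] by (auto simp: S_I_def)
  define s where "s = (\<Sum>j\<in>{1,2,3,4,5,6,7,8}. S_I j x)"
  have total: "(\<Sum>l\<in>idx. x l) = 1"
    using x by (simp add: Delta27_def idx_def)
  have sJ: "(\<Sum>i\<in>{1,2,3,4}. S_J i x) = 1"
    using total by (simp add: S_J_def J_block_explicit idx_explicit)
  have sI: "s = 1 - (x 7 + x 14 + x 21 + x 28)"
    using total by (simp add: s_def S_I_def I_block_explicit idx_explicit)
  \<comment> \<open>The four \<open>J_block\<close> sums have mean 1/4, so the slope term drops
    out.\<close>
  have "4 * \<psi> (1 / 4) \<le> (\<Sum>i\<in>{1,2,3,4}. \<psi> (S_J i x))"
    using sum_odds_div_tangent[of a "1 / 4" "{1,2,3,4}" "\<lambda>i. S_J i x", unfolded sJ] a S_J_bounds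
    by (simp add: \<psi>_def)
  then have "4 * \<psi> (1 / 4) < x 7 + x 14 + x 21 + x 28"
    using Jcl[of 7 1] Jcl[of 14 2] Jcl[of 21 3] Jcl[of 28 4] by simp
  then have s_less: "s < 8 * b"
    using sI block_value_J[OF a(1)] by (simp add: b_def \<psi>_def)
  have sJc: "(\<Sum>i\<in>{1,2,3,4}. 1 - S_J i x) = 3"
    using sJ by simp
  have A: "4 * \<psi> (3 / 4) \<le> (\<Sum>i\<in>{1,2,3,4}. \<psi> (1 - S_J i x))"
    using sum_odds_div_tangent[of a "3 / 4" "{1,2,3,4}" "\<lambda>i. 1 - S_J i x", unfolded sJc] a S_J_bounds
    by (simp add: \<psi>_def)
  have B: "8 * \<psi> b + odds_div_slope a b * (s - 8 * b) \<le> (\<Sum>j\<in>{1,2,3,4,5,6,7,8}. \<psi> (S_I j x))"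
    using sum_odds_div_tangent[of a b "{1,2,3,4,5,6,7,8}" "\<lambda>j. S_I j x", folded s_def] a S_I_le
      block_value_bounds[OF a(1)]
    by (simp add: \<psi>_def b_def)
  \<comment> \<open>The remaining 24 coordinates add up to \<open>s\<close>; each
    \<open>J_block\<close> and each \<open>I_block\<close> bounds exactly two of them.\<close>
  have "2 * (\<Sum>i\<in>{1,2,3,4}. \<psi> (1 - S_J i x)) + 2 * (\<Sum>j\<in>{1,2,3,4,5,6,7,8}. \<psi> (S_I j x)) < s"
    using Jl[of 1 1] Jl[of 5 1] Jl[of 9 2] Jl[of 13 2] Jl[of 15 3] Jl[of 19 3] Jl[of 23 4] Jl[of 27 4]
      Il[of 3 1] Il[of 12 1] Il[of 4 2] Il[of 20 2] Il[of 10 3] Il[of 22 3] Il[of 2 4] Il[of 11 4]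
      Il[of 17 5] Il[of 26 5] Il[of 6 6] Il[of 18 6] Il[of 8 7] Il[of 24 7] Il[of 16 8] Il[of 25 8]
      sI total by (simp add: idx_explicit)
  \<comment> \<open>Eight copies of \<open>block_value_I\<close> collapse the constant terms to
    \<open>8 * b\<close>.\<close>
  then have "8 * b + 2 * odds_div_slope a b * (s - 8 * b) < s"
    using A B block_value_I[OF a] by (simp add: b_def \<psi>_def)
  then have "0 < (1 - 2 * odds_div_slope a b) * (s - 8 * b)"
    by (simp add: algebra_simps)
  then have "1 < 2 * odds_div_slope a b"
    using s_less by (simp add: zero_less_mult_iff)
  \<comment> \<open>As \<open>b\<close> is below 1/8, the denominator is at least
    \<open>a / 2\<close>, so the slope is at most \<open>4 / a\<close>, which is below 1/2.\<close>
  moreover have "2 * odds_div_slope a b \<le> 1"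
  proof -
    have "(a - 1) * b \<le> (a - 1) * (1 / 8)"
      using a(1) block_value_bounds[OF a(1)] by (intro mult_left_mono) (auto simp: b_def)
    then have d: "a / 2 \<le> a - (a - 1) * b"
      using a(1) by argo
    have "2 * a \<le> (a / 2)\<^sup>2"
      using a(1) by (simp add: power2_eq_square)
    also have "\<dots> \<le> (a - (a - 1) * b)\<^sup>2"
      using d a(1) by (intro power_mono) auto
    finally show ?thesis
      using d a(1) by (simp add: odds_div_slope_def)
  qed
  ultimately show False by simp
qed

section \<open>The symmetric point and the upper bound\<close>

text \<open>The three cases follow the three families in \<open>f_funs\<close>; each value turns the
  corresponding bound into an equality. The restricted lambda makes the point extensional.\<close>

definition sym_point :: "real \<Rightarrow> nat \<Rightarrow> real" where
  "sym_point a = (\<lambda>l\<in>{1..28}. if l \<in> {1,5,9,13,15,19,23,27} then odds_div a (3 / 4)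
     else if l \<in> {7,14,21,28} then odds_div a (1 / 4) else odds_div a (block_value a))"

lemma odds_div_pos: "1 < a \<Longrightarrow> 0 < t \<Longrightarrow> t \<le> 1 \<Longrightarrow> 0 < odds_div a t"
  using odds_div_denom_pos[of a t] by (simp add: odds_div_def)

text \<open>The eight \<open>I_block\<close> sums and the four remaining coordinates add up to four
  times the left side of \<open>block_value_J\<close>.\<close>

lemma sym_point_Delta27:
  assumes "9 < a" "poly alpha_poly a = 0"
  shows "sym_point a \<in> Delta27"
proof -
  have "(\<Sum>l\<in>idx. sym_point a l) = 1"
    using block_value_J[OF assms(1)] block_value_I[OF assms]
    by (simp add: idx_explicit sym_point_def)
  moreover have "0 < sym_point a l" if "l \<in> {1..28}" for l
    using that assms block_value_bounds[OF assms(1)]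
    by (auto simp: sym_point_def intro!: odds_div_pos)
  ultimately show ?thesis
    by (simp add: Delta27_def idx_def) (simp add: sym_point_def)
qed

lemma G_sym_point_le:
  assumes a: "9 < a" "poly alpha_poly a = 0"
  shows "G (sym_point a) \<le> a"
proof -
  define A B C where "A = odds_div a (3 / 4)" and "B = odds_div a (block_value a)"
    and "C = odds_div a (1 / 4)"
  define x where "x = sym_point a"
  have x: "x \<in> Delta27"
    using sym_point_Delta27[OF a] by (simp add: x_def)
  have val: "x l = (if l \<in> {1,5,9,13,15,19,23,27} then A else if l \<in> {7,14,21,28} then C else B)"
    if "l \<in> idx" for l
    using that by (simp add: x_def sym_point_def A_def B_def C_def idx_def)
  have J_sum: "S_J i x = 1 / 4" if "i \<in> {1,2,3,4}" for i
    using that block_value_J[OF a(1)] block_value_I[OF a]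
    by (auto simp: S_J_def J_block_explicit val idx_def A_def B_def C_def)
  have I_sum: "S_I j x = block_value a" if "j \<in> {1,2,3,4,5,6,7,8}" for j
    using that block_value_I[OF a]
    by (auto simp: S_I_def I_block_explicit val idx_def A_def B_def)
  have pos: "0 < A" "0 < B" "0 < C"
    using a(1) block_value_bounds[OF a(1)] by (auto simp: A_def B_def C_def intro!: odds_div_pos)
  have b_eq: "A + 2 * B = block_value a" "2 * block_value a + C = 1 / 4"
    using block_value_J[OF a(1)] block_value_I[OF a] by (simp_all add: A_def B_def C_def)
  have "C = 1 / (3 * a + 1)"
    using a(1) by (simp add: C_def odds_div_def field_simps)
  also have "\<dots> < 1 / 12"
    using a(1) by (simp add: field_simps)
  finally have "C < block_value a"
    using block_value_bounds[OF a(1)] by simp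
  \<comment> \<open>All four follow by monotonicity from comparing arguments: \<open>C\<close> with
    \<open>block_value a\<close>, \<open>B\<close> with 1/4, \<open>C\<close> with 3/4, and
    \<open>block_value a\<close> with 3/4.\<close>
  then have mono: "odds_div a C \<le> B" "odds_div a B \<le> C" "odds_div a C \<le> A" "B \<le> A"
    using a(1) block_value_bounds[OF a(1)] b_eq pos unfolding A_def B_def C_def
    by (intro odds_div_mono; simp)+
  have J: "\<sigma> (S_J i x) * \<sigma> (x l) \<le> a"
    if "i \<in> {1,2,3,4}" "l \<in> {1,5,9,13,15,19,23,27}" for i l
  proof -
    have "x l = A" "l \<in> idx"
      using that(2) by (auto simp: val idx_def)
    then show ?thesis
      using Delta27_sigma_le_iff[OF x, of a "J_block i" l] a(1) J_block_psubset[OF that(1)]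
      by (simp add: J_sum[OF that(1)] A_def flip: S_J_def)
  qed
  have Jc: "\<sigma> (S_Jc i x) * \<sigma> (x l) \<le> a" if "i \<in> {1,2,3,4}" "l \<in> {7,14,21,28}" for i l
  proof -
    have "x l = C" "l \<in> idx"
      using that(2) by (auto simp: val idx_def)
    moreover have "idx - J_block i \<subset> idx" "idx - J_block i \<noteq> {}"
      using J_block_psubset[OF that(1)] by blast+
    ultimately show ?thesis
      using Delta27_sigma_le_iff[OF x, of a "idx - J_block i" l] a(1)
      by (simp add: S_Jc_eq[OF x that(1)] J_sum[OF that(1)] C_def flip: S_Jc_def)
  qed
  \<comment> \<open>Covers the members of \<open>f_funs\<close> with \<open>x l = B\<close> and
    those of \<open>g_funs\<close> with \<open>x l = A\<close>, since
    \<open>B \<le> A\<close>.\<close>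
  have Ic: "\<sigma> (S_Ic j x) * \<sigma> (x l) \<le> a"
    if "j \<in> {1,2,3,4,5,6,7,8}" "l \<in> idx" "l \<notin> {7,14,21,28}" for j l
  proof -
    have "B \<le> x l"
      using that(3) mono(4) by (simp add: val[OF that(2)])
    moreover have "idx - I_block j \<subset> idx" "idx - I_block j \<noteq> {}"
      using I_block_psubset[OF that(1)] by blast+
    ultimately show ?thesis
      using Delta27_sigma_le_iff[OF x, of a "idx - I_block j" l] a(1) that(2)
      by (simp add: S_Ic_eq[OF x that(1)] I_sum[OF that(1)] B_def flip: S_Ic_def)
  qed
  \<comment> \<open>The first disjunct fits the pairs with \<open>x n = C\<close> in
    \<open>g_funs\<close> and \<open>h_funs\<close>, the second those with \<open>x n = B\<close> in
    \<open>h_funs\<close> and \<open>u_funs\<close>.\<close>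
  have pt: "\<sigma> (S_pt n x) * \<sigma> (x l) \<le> a"
    if "n \<in> idx" "l \<in> idx" "n \<in> {7,14,21,28} \<and> l \<notin> {7,14,21,28} \<or>
      n \<notin> {1,5,9,13,15,19,23,27} \<and> n \<notin> {7,14,21,28} \<and> l \<in> {7,14,21,28}" for n l
  proof -
    have "odds_div a (x n) \<le> x l"
      using that(3) mono by (auto simp: val[OF that(1)] val[OF that(2)])
    moreover have "idx - {n} \<subset> idx" "idx - {n} \<noteq> {}"
      using singleton_psubset_idx[OF that(1)] by blast+
    ultimately show ?thesis
      using Delta27_sigma_le_iff[OF x, of a "idx - {n}" l] a(1) that(2)
      by (simp add: S_pt_eq[OF x that(1)] flip: S_pt_def)
  qed
  have "\<forall>f\<in>\<G>. f x \<le> a"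
    unfolding \<G>_def f_funs_def g_funs_def h_funs_def u_funs_def
    by (simp add: ball_Un J Jc Ic pt idx_def)
  then show ?thesis
    by (simp add: G_le_iff x_def)
qed

section \<open>The root of the quartic\<close>

lemma alpha_exists:
  "\<exists>a::real. 24.8692 \<le> a \<and> a < 24.8693 \<and> poly alpha_poly a = 0"
proof -
  have "\<exists>a::real. 24.8692 < a \<and> a < 24.8693 \<and> poly alpha_poly a = 0"
    by (intro poly_IVT_pos) (simp_all add: alpha_poly_def)
  then show ?thesis by (auto intro: less_imp_le)
qed

text \<open>The difference of the polynomial values factors as \<open>(a - b) * q\<close>, and
  \<open>q\<close> is positive at roots above 9.\<close>

lemma alpha_unique:
  fixes a b :: real
  assumes "poly alpha_poly a = 0" "poly alpha_poly b = 0" "9 < a" "9 < b"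
  shows "a = b"
proof -
  \<comment> \<open>At a root the two leading terms must balance
    \<open>654 * x\<^sup>2 - 24 * x - 81\<close>, which is positive for \<open>x\<close> above
    9.\<close>
  have root: "496 < 21 * x" if "poly alpha_poly x = 0" "9 < x" for x :: real
  proof -
    have "x ^ 3 * (21 * x - 496) = 654 * x\<^sup>2 - 24 * x - 81"
      using that(1) unfolding alpha_poly_def by simp algebra
    also have "\<dots> = x * (654 * x - 24) - 81"
      by (simp add: algebra_simps power2_eq_square)
    also have "\<dots> > 0"
      using that(2) mult_strict_mono[of 9 x 100 "654 * x - 24"] by simp
    finally show ?thesis
      using that(2) by (simp add: zero_less_mult_iff)
  qed
  have ab: "496 < 21 * a" "496 < 21 * b"
    using root assms by auto
  \<comment> \<open>The divided difference of the polynomial, grouped so that each group is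
    nonnegative once both roots exceed 496/21.\<close>
  define q where "q = a\<^sup>2 * (21 * a - 496) + b\<^sup>2 * (21 * b - 496)
    + (a * b * (21 * (a + b) - 496) - 654 * (a + b)) + 24"
  have "(a - b) * q = poly alpha_poly a - poly alpha_poly b"
    unfolding q_def alpha_poly_def by simp algebra
  then have "(a - b) * q = 0"
    using assms by simp
  moreover have "0 < q"
  proof -
    \<comment> \<open>Both roots exceed 20 because 496/21 does; this makes \<open>a * b\<close>
      dominate \<open>a + b\<close>.\<close>
    have "0 \<le> (a - 20) * b + (b - 20) * a"
      using ab by (intro add_nonneg_nonneg mult_nonneg_nonneg) auto
    then have "10 * (a + b) \<le> a * b"
      by (simp add: algebra_simps)
    moreover have "0 \<le> a + b"
      using ab by simp
    ultimately have "654 * (a + b) \<le> 496 * (a * b)"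
      by argo
    also have "\<dots> \<le> (21 * (a + b) - 496) * (a * b)"
      using ab by (intro mult_right_mono) auto
    finally have "0 \<le> a * b * (21 * (a + b) - 496) - 654 * (a + b)"
      by (simp add: mult.commute)
    moreover have "0 \<le> a\<^sup>2 * (21 * a - 496)" "0 \<le> b\<^sup>2 * (21 * b - 496)"
      using ab by simp_all
    ultimately show ?thesis
      unfolding q_def by linarith
  qed
  ultimately show ?thesis by simp
qed

theorem theorem3p4:
  shows "\<exists>\<alpha>::real.
           (poly alpha_poly \<alpha> = 0 \<and> 9 < \<alpha>) \<and>
           (\<forall>\<beta>::real. poly alpha_poly \<beta> = 0 \<and> 9 < \<beta> \<longrightarrow> \<beta> = \<alpha>) \<and>
           24.8692 \<le> \<alpha> \<and> \<alpha> < 24.8693 \<and>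
           bdd_below (G ` Delta27) \<and>
           (INF x\<in>Delta27. G x) = \<alpha>"
proof -
  obtain a :: real where a: "24.8692 \<le> a" "a < 24.8693" "poly alpha_poly a = 0"
    using alpha_exists by blast
  then have "9 < a" by simp
  note x = sym_point_Delta27[OF \<open>9 < a\<close> a(3)]
  have bdd: "bdd_below (G ` Delta27)"
    using G_ge[OF \<open>9 < a\<close> a(3)] by (intro bdd_belowI2[of _ a]) auto
  \<comment> \<open>The infimum is attained, at \<open>sym_point a\<close>.\<close>
  have "(INF x\<in>Delta27. G x) = a"
  proof (rule antisym)
    show "(INF x\<in>Delta27. G x) \<le> a"
      using cINF_lower[OF bdd x] G_sym_point_le[OF \<open>9 < a\<close> a(3)] by (rule order_trans)
    show "a \<le> (INF x\<in>Delta27. G x)"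
      using x G_ge[OF \<open>9 < a\<close> a(3)] by (intro cINF_greatest) auto
  qed
  moreover have "\<forall>\<beta>. poly alpha_poly \<beta> = 0 \<and> 9 < \<beta> \<longrightarrow> \<beta> = a"
    using alpha_unique[OF _ a(3) _ \<open>9 < a\<close>] by blast
  ultimately show ?thesis
    using a \<open>9 < a\<close> bdd by blast
qed

end
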